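(* Let $(M,L)$ be a Finsler manifold of dimension $n\geq3$. Then $(M,L)$ is concircularly flat if, and only if, $(M,L)$ is $h$-isotropic.
   Context: Setting. $(M,L)$ is a Finsler manifold (in the usual sense: $L:TM\to[0,\infty)$ is smooth on nonzero vectors, positively homogeneous of degree 1 in the fibre variable $y$, and the vertical Hessian $g$ of $\frac12L^2$ is positive definite). $\pi:\mathcal{T}M\to M$ is the bundle of nonzero tangent vectors, $\pi^{-1}(TM)$ is the pullback bundle over $\mathcal{T}M$, and $g$ is regarded as a metric on $\pi^{-1}(TM)$. Sections of $\pi^{-1}(TM)$ are called $\pi$-vector fields, denoted $\overline{X},\overline{Y},\dots$; tensor fields on $\pi^{-1}(TM)$ are called $\pi$-tensor fields. The fundamental $\pi$-vector field is $\overline{\eta}(u)=(u,u)$. In the exact sequence $0\to\pi^{-1}(TM)\xrightarrow{\gamma}T(\mathcal{T}M)\xrightarrow{\rho}\pi^{-1}(TM)\to0$, $\gamma(u,v)=\frac{d}{dt}\big|_{0}(u+tv)$ is the vertical lift and $\rho(X)=(u,d\pi(X))$ for $X\in T_u(\mathcal{T}M)$. Connections. For a linear connection $D$ on $\pi^{-1}(TM)$ let $K(X)=D_X\overline{\eta}$; the horizontal space at $u$ is $H_u=\{X\in T_u(\mathcal{T}M):K(X)=0\}$ and the vertical space is $V_u=\ker d\pi$; $D$ is regular if $T_u(\mathcal{T}M)=V_u\oplus H_u$ for all $u$, and then $\beta:=(\rho|_{H})^{-1}$ is the horizontal map. The classical torsion is $\mathbf{T}(X,Y)=D_X\rho Y-D_Y\rho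 X-\rho[X,Y]$, with $Q(\overline{X},\overline{Y})=\mathbf{T}(\beta\overline{X},\beta\overline{Y})$ and $T(\overline{X},\overline{Y})=\mathbf{T}(\gamma\overline{X},\beta\overline{Y})$. The Cartan connection $\nabla$ is the unique regular connection on $\pi^{-1}(TM)$ with $\nabla g=0$, $Q=0$ and $g(T(\overline{X},\overline{Y}),\overline{Z})=g(T(\overline{X},\overline{Z}),\overline{Y})$. Curvature. The classical curvature is taken with the sign convention $\mathbf{K}(X,Y)\overline{Z}=-\nabla_X\nabla_Y\overline{Z}+\nabla_Y\nabla_X\overline{Z}+\nabla_{[X,Y]}\overline{Z}$. The horizontal curvature tensor is $R(\overline{X},\overline{Y})\overline{Z}=\mathbf{K}(\beta\overline{X},\beta\overline{Y})\overline{Z}$. The horizontal Ricci tensor is $Ric(\overline{X},\overline{Z})=\mathrm{Tr}\{\overline{Y}\mapsto R(\overline{X},\overline{Y})\overline{Z}\}$ and the horizontal scalar curvature $r$ is its $g$-trace. $G$ is the $\pi$-tensor field $G(\overline{X},\overline{Y})\overline{Z}=g(\overline{X},\overline{Z})\overline{Y}-g(\overline{Y},\overline{Z})\overline{X}$. Definitions. The concircular curvature tensor of $(M,L)$ ($n\ge3$) is $C:=R-\frac{r}{n(n-1)}G$; $(M,L)$ is concircularly flat if $C=0$. $(M,L)$ ($n\ge3$) is $h$-isotropic if there exists a scalar function $k_o\neq0$ such that $R=k_o\,G$.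
   Formalization: Adds the hypothesis that the horizontal curvature R is not identically zero: if R = 0 (e.g. Euclidean space) then C = 0, but R = k_o G with k_o ≠ 0 fails. Here k_o ≠ 0 is read as "not the zero function". *)

theory Defs
  imports "HOL-Analysis.Analysis"
begin

section \<open>Smooth maps between Euclidean spaces\<close>

text \<open>Only used for open sets \<open>S\<close>.\<close>

primrec Ck_on :: "nat \<Rightarrow> 'e::euclidean_space set \<Rightarrow> ('e \<Rightarrow> 'f::real_normed_vector) \<Rightarrow> bool" where
  "Ck_on 0 S = (\<lambda>f. continuous_on S f)"
| "Ck_on (Suc k) S = (\<lambda>f. (\<forall>x\<in>S. f differentiable (at x)) \<and>
     (\<forall>v. Ck_on k S (\<lambda>x. frechet_derivative f (at x) v)))"

definition smooth_on :: "'e::euclidean_space set \<Rightarrow> ('e \<Rightarrow> 'f::real_normed_vector) \<Rightarrow> bool" where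
  "smooth_on S f \<longleftrightarrow> (\<forall>k. Ck_on k S f)"


section \<open>Smooth manifolds\<close>

text \<open>
  A chart is a pair of a domain and a coordinate map (total as a HOL function, only used on the
  domain). A manifold is given by a smooth atlas; its set of points is the union of the chart
  domains and its topology is the one induced by the charts.
\<close>

type_synonym ('a, 'e) chart = "'a set \<times> ('a \<Rightarrow> 'e)"
type_synonym ('a, 'e) atlas = "('a, 'e) chart set"

abbreviation cdom :: "('a, 'e) chart \<Rightarrow> 'a set" where "cdom \<equiv> fst"
abbreviation cmap :: "('a, 'e) chart \<Rightarrow> 'a \<Rightarrow> 'e" where "cmap \<equiv> snd"

definition cimg :: "('a, 'e) chart \<Rightarrow> 'e set" where
  "cimg c = cmap c ` cdom c"

definition cinv :: "('a, 'e) chart \<Rightarrow> 'e \<Rightarrow> 'a" where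
  "cinv c = inv_into (cdom c) (cmap c)"

definition points :: "('a, 'e) atlas \<Rightarrow> 'a set" where
  "points A = (\<Union>c\<in>A. cdom c)"

definition atlas_topology :: "('a, 'e::euclidean_space) atlas \<Rightarrow> 'a topology" where
  "atlas_topology A =
     topology (\<lambda>U. U \<subseteq> points A \<and> (\<forall>c\<in>A. open (cmap c ` (U \<inter> cdom c))))"

definition smooth_manifold :: "('a, 'e::euclidean_space) atlas \<Rightarrow> bool" where
  "smooth_manifold A \<longleftrightarrow>
     (\<forall>c\<in>A. inj_on (cmap c) (cdom c) \<and> open (cimg c)) \<and>
     (\<forall>c\<in>A. \<forall>d\<in>A. open (cmap c ` (cdom c \<inter> cdom d)) \<and>
        smooth_on (cmap c ` (cdom c \<inter> cdom d)) (cmap d \<circ> cinv c)) \<and>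
     Hausdorff_space (atlas_topology A) \<and> second_countable (atlas_topology A)"

lemma openin_atlas_topology:
  fixes A :: "('a, 'e::euclidean_space) atlas"
  assumes inj: "\<forall>c\<in>A. inj_on (cmap c) (cdom c)"
  shows "openin (atlas_topology A) U \<longleftrightarrow>
           U \<subseteq> points A \<and> (\<forall>c\<in>A. open (cmap c ` (U \<inter> cdom c)))"
proof -
  let ?P = "\<lambda>U. U \<subseteq> points A \<and> (\<forall>c\<in>A. open (cmap c ` (U \<inter> cdom c)))"
  have "?P (S \<inter> T)" if "?P S" "?P T" for S T
  proof -
    have "cmap c ` (S \<inter> T \<inter> cdom c) = cmap c ` (S \<inter> cdom c) \<inter> cmap c ` (T \<inter> cdom c)"
      if "c \<in> A" for c
      using inj that unfolding inj_on_def by blast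
    then show ?thesis using that by auto
  qed
  moreover have "?P (\<Union>\<K>)" if "\<forall>U\<in>\<K>. ?P U" for \<K>
  proof -
    have "open (cmap c ` (\<Union>\<K> \<inter> cdom c))" if "c \<in> A" for c
    proof -
      have "open (\<Union>U\<in>\<K>. cmap c ` (U \<inter> cdom c))"
        using \<open>\<forall>U\<in>\<K>. ?P U\<close> that by (intro open_UN) blast
      moreover have "cmap c ` (\<Union>\<K> \<inter> cdom c) = (\<Union>U\<in>\<K>. cmap c ` (U \<inter> cdom c))"
        by blast
      ultimately show ?thesis by simp
    qed
    then show ?thesis using that by blast
  qed
  ultimately have "istopology ?P"
    unfolding istopology_def by blast
  then show ?thesis
    unfolding atlas_topology_def by simp
qed


section \<open>Tangent vectors\<close>

text \<open>
  The tangent space at \<open>p\<close> is the model space itself: a tangent vector at \<open>p\<close> is given by its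
  components in a chart \<open>chart_at A p\<close> chosen once and for all. \<open>components A c p v\<close> are
  the components in an arbitrary chart \<open>c\<close> around \<open>p\<close>, by the usual transformation law.
\<close>

definition chart_at :: "('a, 'e) atlas \<Rightarrow> 'a \<Rightarrow> ('a, 'e) chart" where
  "chart_at A p = (SOME c. c \<in> A \<and> p \<in> cdom c)"

definition components ::
    "('a, 'e::euclidean_space) atlas \<Rightarrow> ('a, 'e) chart \<Rightarrow> 'a \<Rightarrow> 'e \<Rightarrow> 'e" where
  "components A c p =
     frechet_derivative (cmap c \<circ> cinv (chart_at A p)) (at (cmap (chart_at A p) p))"

definition smooth_fun :: "('a, 'e::euclidean_space) atlas \<Rightarrow> ('a \<Rightarrow> real) \<Rightarrow> bool" where
  "smooth_fun A f \<longleftrightarrow> (\<forall>c\<in>A. smooth_on (cimg c) (f \<circ> cinv c))"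

text \<open>\<open>dir_deriv A p X f\<close> is \<open>X(f)\<close> for a tangent vector \<open>X\<close> at \<open>p\<close>.\<close>

definition dir_deriv :: "('a, 'e::euclidean_space) atlas \<Rightarrow> 'a \<Rightarrow> 'e \<Rightarrow> ('a \<Rightarrow> real) \<Rightarrow> real" where
  "dir_deriv A p X f =
     frechet_derivative (f \<circ> cinv (chart_at A p)) (at (cmap (chart_at A p) p)) X"

definition tangent_map :: "('a, 'e::euclidean_space) atlas \<Rightarrow> ('b, 'f::euclidean_space) atlas \<Rightarrow>
    ('a \<Rightarrow> 'b) \<Rightarrow> 'a \<Rightarrow> 'e \<Rightarrow> 'f" where
  "tangent_map A B f p =
     frechet_derivative (cmap (chart_at B (f p)) \<circ> f \<circ> cinv (chart_at A p))
       (at (cmap (chart_at A p) p))"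

text \<open>The velocity at time \<open>0\<close> of a curve.\<close>

definition velocity :: "('a, 'e::euclidean_space) atlas \<Rightarrow> (real \<Rightarrow> 'a) \<Rightarrow> 'e" where
  "velocity A \<gamma> = vector_derivative (cmap (chart_at A (\<gamma> 0)) \<circ> \<gamma>) (at 0)"

definition local_rep ::
    "('a, 'e::euclidean_space) atlas \<Rightarrow> ('a, 'e) chart \<Rightarrow> ('a \<Rightarrow> 'e) \<Rightarrow> 'e \<Rightarrow> 'e" where
  "local_rep A c X = (\<lambda>x. components A c (cinv c x) (X (cinv c x)))"

definition smooth_vector_field :: "('a, 'e::euclidean_space) atlas \<Rightarrow> ('a \<Rightarrow> 'e) \<Rightarrow> bool" where
  "smooth_vector_field A X \<longleftrightarrow> (\<forall>c\<in>A. smooth_on (cimg c) (local_rep A c X))"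

text \<open>
  The coordinate formula \<open>[X,Y] = DY\<cdot>X - DX\<cdot>Y\<close>, in the chart in which tangent vectors at \<open>p\<close> are
  expressed; there the components of \<open>X p\<close> and \<open>Y p\<close> are \<open>X p\<close> and \<open>Y p\<close> themselves.
\<close>

definition lie_bracket ::
    "('a, 'e::euclidean_space) atlas \<Rightarrow> ('a \<Rightarrow> 'e) \<Rightarrow> ('a \<Rightarrow> 'e) \<Rightarrow> 'a \<Rightarrow> 'e" where
  "lie_bracket A X Y p =
     (let c = chart_at A p in
        frechet_derivative (local_rep A c Y) (at (cmap c p)) (X p)
        - frechet_derivative (local_rep A c X) (at (cmap c p)) (Y p))"


section \<open>The slit tangent bundle and the pullback bundle\<close>

text \<open>
  A point of the slit tangent bundle is a pair \<open>u = (p, y)\<close> of a point and a nonzero tangent vector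
  at \<open>p\<close>; the bundle projection is \<open>fst\<close>. The slit tangent bundle is again a manifold, with the
  charts induced by those of the base.
\<close>

definition tangent_chart :: "('a, 'e::euclidean_space) atlas \<Rightarrow> ('a, 'e) chart \<Rightarrow>
    ('a \<times> 'e, 'e \<times> 'e) chart" where
  "tangent_chart A c =
     ({(p, y). p \<in> cdom c \<and> y \<noteq> 0}, \<lambda>(p, y). (cmap c p, components A c p y))"

definition slit_tangent :: "('a, 'e::euclidean_space) atlas \<Rightarrow> ('a \<times> 'e, 'e \<times> 'e) atlas" where
  "slit_tangent A = tangent_chart A ` A"

text \<open>
  The fibre of the pullback bundle over \<open>u = (p, y)\<close> is the tangent space at \<open>p\<close>; the element
  \<open>(u, v)\<close> of this fibre is represented by \<open>v\<close>. Accordingly the fundamental section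
  \<open>u \<mapsto> (u, u)\<close> is \<open>(p, y) \<mapsto> y\<close>.
\<close>

definition pi_vector_field ::
    "('a, 'e::euclidean_space) atlas \<Rightarrow> ('a \<times> 'e \<Rightarrow> 'e) \<Rightarrow> bool" where
  "pi_vector_field A Z \<longleftrightarrow>
     (\<forall>c\<in>A. smooth_on (cimg (tangent_chart A c))
        (\<lambda>w. let u = cinv (tangent_chart A c) w in components A c (fst u) (Z u)))"

definition fundamental :: "'a \<times> 'e \<Rightarrow> 'e" where
  "fundamental u = snd u"

definition vertical_lift ::
    "('a, 'e::euclidean_space) atlas \<Rightarrow> 'a \<times> 'e \<Rightarrow> 'e \<Rightarrow> 'e \<times> 'e" where
  "vertical_lift A u v = velocity (slit_tangent A) (\<lambda>t. (fst u, snd u + t *\<^sub>R v))"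

definition rho :: "('a, 'e::euclidean_space) atlas \<Rightarrow> 'a \<times> 'e \<Rightarrow> 'e \<times> 'e \<Rightarrow> 'e" where
  "rho A u X = tangent_map (slit_tangent A) A fst u X"

definition vertical_space :: "('a, 'e::euclidean_space) atlas \<Rightarrow> 'a \<times> 'e \<Rightarrow> ('e \<times> 'e) set" where
  "vertical_space A u = {X. rho A u X = 0}"


section \<open>Linear connections on the pullback bundle\<close>

text \<open>
  \<open>D u X Z\<close> is the covariant derivative at \<open>u\<close> of the section \<open>Z\<close> in the direction of the tangent
  vector \<open>X\<close> at \<open>u\<close>.
\<close>

type_synonym ('a, 'e) pi_connection = "'a \<times> 'e \<Rightarrow> 'e \<times> 'e \<Rightarrow> ('a \<times> 'e \<Rightarrow> 'e) \<Rightarrow> 'e"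

definition linear_connection ::
    "('a, 'e::euclidean_space) atlas \<Rightarrow> ('a, 'e) pi_connection \<Rightarrow> bool" where
  "linear_connection A D \<longleftrightarrow>
     (\<forall>u\<in>points (slit_tangent A). \<forall>Z. pi_vector_field A Z \<longrightarrow> linear (\<lambda>X. D u X Z)) \<and>
     (\<forall>u\<in>points (slit_tangent A). \<forall>X Y Z. pi_vector_field A Y \<longrightarrow> pi_vector_field A Z \<longrightarrow>
        D u X (\<lambda>w. Y w + Z w) = D u X Y + D u X Z) \<and>
     (\<forall>u\<in>points (slit_tangent A). \<forall>X f Z. smooth_fun (slit_tangent A) f \<longrightarrow> pi_vector_field A Z \<longrightarrow>
        D u X (\<lambda>w. f w *\<^sub>R Z w) = f u *\<^sub>R D u X Z + dir_deriv (slit_tangent A) u X f *\<^sub>R Z u) \<and>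
     (\<forall>X Z. smooth_vector_field (slit_tangent A) X \<longrightarrow> pi_vector_field A Z \<longrightarrow>
        pi_vector_field A (\<lambda>u. D u (X u) Z))"

definition horizontal_space :: "('a, 'e) pi_connection \<Rightarrow> 'a \<times> 'e::euclidean_space \<Rightarrow> ('e \<times> 'e) set" where
  "horizontal_space D u = {X. D u X fundamental = 0}"

definition regular_connection ::
    "('a, 'e::euclidean_space) atlas \<Rightarrow> ('a, 'e) pi_connection \<Rightarrow> bool" where
  "regular_connection A D \<longleftrightarrow> linear_connection A D \<and>
     (\<forall>u\<in>points (slit_tangent A).
        vertical_space A u \<inter> horizontal_space D u = {0} \<and>
        (\<forall>X. \<exists>V\<in>vertical_space A u. \<exists>H\<in>horizontal_space D u. X = V + H))"

definition horizontal_map :: "('a, 'e::euclidean_space) atlas \<Rightarrow> ('a, 'e) pi_connection \<Rightarrow>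
    'a \<times> 'e \<Rightarrow> 'e \<Rightarrow> 'e \<times> 'e" where
  "horizontal_map A D u = inv_into (horizontal_space D u) (rho A u)"

definition classical_torsion :: "('a, 'e::euclidean_space) atlas \<Rightarrow> ('a, 'e) pi_connection \<Rightarrow>
    ('a \<times> 'e \<Rightarrow> 'e \<times> 'e) \<Rightarrow> ('a \<times> 'e \<Rightarrow> 'e \<times> 'e) \<Rightarrow> 'a \<times> 'e \<Rightarrow> 'e" where
  "classical_torsion A D X Y u =
     D u (X u) (\<lambda>w. rho A w (Y w)) - D u (Y u) (\<lambda>w. rho A w (X w))
     - rho A u (lie_bracket (slit_tangent A) X Y u)"

definition h_torsion :: "('a, 'e::euclidean_space) atlas \<Rightarrow> ('a, 'e) pi_connection \<Rightarrow>
    ('a \<times> 'e \<Rightarrow> 'e) \<Rightarrow> ('a \<times> 'e \<Rightarrow> 'e) \<Rightarrow> 'a \<times> 'e \<Rightarrow> 'e" where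
  "h_torsion A D X Y = classical_torsion A D
     (\<lambda>w. horizontal_map A D w (X w)) (\<lambda>w. horizontal_map A D w (Y w))"

definition hv_torsion :: "('a, 'e::euclidean_space) atlas \<Rightarrow> ('a, 'e) pi_connection \<Rightarrow>
    ('a \<times> 'e \<Rightarrow> 'e) \<Rightarrow> ('a \<times> 'e \<Rightarrow> 'e) \<Rightarrow> 'a \<times> 'e \<Rightarrow> 'e" where
  "hv_torsion A D X Y = classical_torsion A D
     (\<lambda>w. vertical_lift A w (X w)) (\<lambda>w. horizontal_map A D w (Y w))"

definition classical_curvature :: "('a, 'e::euclidean_space) atlas \<Rightarrow> ('a, 'e) pi_connection \<Rightarrow>
    ('a \<times> 'e \<Rightarrow> 'e \<times> 'e) \<Rightarrow> ('a \<times> 'e \<Rightarrow> 'e \<times> 'e) \<Rightarrow> ('a \<times> 'e \<Rightarrow> 'e) \<Rightarrow> 'a \<times> 'e \<Rightarrow> 'e" where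
  "classical_curvature A D X Y Z u =
     - D u (X u) (\<lambda>w. D w (Y w) Z) + D u (Y u) (\<lambda>w. D w (X w) Z)
     + D u (lie_bracket (slit_tangent A) X Y u) Z"

text \<open>
  The horizontal curvature as a tensor at \<open>u\<close>: its value on fibre elements \<open>x, y, z\<close> is the value
  at \<open>u\<close> of the curvature on sections extending \<open>x, y, z\<close>. It does not depend on the extensions.
\<close>

definition extension :: "('a, 'e::euclidean_space) atlas \<Rightarrow> 'a \<times> 'e \<Rightarrow> 'e \<Rightarrow> 'a \<times> 'e \<Rightarrow> 'e" where
  "extension A u x = (SOME X. pi_vector_field A X \<and> X u = x)"

definition h_curvature :: "('a, 'e::euclidean_space) atlas \<Rightarrow> ('a, 'e) pi_connection \<Rightarrow>
    'a \<times> 'e \<Rightarrow> 'e \<Rightarrow> 'e \<Rightarrow> 'e \<Rightarrow> 'e" where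
  "h_curvature A D u x y z = classical_curvature A D
     (\<lambda>w. horizontal_map A D w (extension A u x w))
     (\<lambda>w. horizontal_map A D w (extension A u y w))
     (extension A u z) u"


section \<open>Finsler manifolds and the Cartan connection\<close>

text \<open>
  The vertical Hessian of \<open>L\<^sup>2/2\<close>. It only involves the restriction of \<open>L\<close> to a fibre, which is a
  vector space, so that it needs no chart.
\<close>

definition finsler_metric :: "('a \<times> (real^'n) \<Rightarrow> real) \<Rightarrow> 'a \<times> (real^'n) \<Rightarrow> real^'n \<Rightarrow> real^'n \<Rightarrow> real" where
  "finsler_metric L u v w =
     deriv (\<lambda>s. deriv (\<lambda>t. (L (fst u, snd u + s *\<^sub>R v + t *\<^sub>R w))\<^sup>2 / 2) 0) 0"

definition finsler_manifold :: "('a, real^'n) atlas \<Rightarrow> ('a \<times> (real^'n) \<Rightarrow> real) \<Rightarrow> bool" where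
  "finsler_manifold A L \<longleftrightarrow>
     smooth_manifold A \<and>
     (\<forall>p\<in>points A. \<forall>y. L (p, y) \<ge> 0) \<and>
     smooth_fun (slit_tangent A) L \<and>
     (\<forall>p\<in>points A. \<forall>y. \<forall>a>0. L (p, a *\<^sub>R y) = a * L (p, y)) \<and>
     (\<forall>u\<in>points (slit_tangent A). \<forall>v. v \<noteq> 0 \<longrightarrow> finsler_metric L u v v > 0)"

definition metric_connection ::
    "('a, real^'n) atlas \<Rightarrow> ('a \<times> (real^'n) \<Rightarrow> real) \<Rightarrow> ('a, real^'n) pi_connection \<Rightarrow> bool" where
  "metric_connection A L D \<longleftrightarrow>
     (\<forall>u\<in>points (slit_tangent A). \<forall>X Y Z. pi_vector_field A Y \<longrightarrow> pi_vector_field A Z \<longrightarrow>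
        dir_deriv (slit_tangent A) u X (\<lambda>w. finsler_metric L w (Y w) (Z w)) =
          finsler_metric L u (D u X Y) (Z u) + finsler_metric L u (Y u) (D u X Z))"

definition cartan_connection ::
    "('a, real^'n) atlas \<Rightarrow> ('a \<times> (real^'n) \<Rightarrow> real) \<Rightarrow> ('a, real^'n) pi_connection \<Rightarrow> bool" where
  "cartan_connection A L D \<longleftrightarrow>
     regular_connection A D \<and>
     metric_connection A L D \<and>
     (\<forall>u\<in>points (slit_tangent A). \<forall>X Y. pi_vector_field A X \<longrightarrow> pi_vector_field A Y \<longrightarrow>
        h_torsion A D X Y u = 0) \<and>
     (\<forall>u\<in>points (slit_tangent A). \<forall>X Y Z.
        pi_vector_field A X \<longrightarrow> pi_vector_field A Y \<longrightarrow> pi_vector_field A Z \<longrightarrow>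
        finsler_metric L u (hv_torsion A D X Y u) (Z u) =
          finsler_metric L u (hv_torsion A D X Z u) (Y u))"


section \<open>Concircular curvature\<close>

definition h_ricci :: "('a, real^'n) atlas \<Rightarrow> ('a, real^'n) pi_connection \<Rightarrow>
    'a \<times> (real^'n) \<Rightarrow> real^'n \<Rightarrow> real^'n \<Rightarrow> real" where
  "h_ricci A D u x z = trace (matrix (\<lambda>y. h_curvature A D u x y z))"

definition gram_matrix :: "(real^'n \<Rightarrow> real^'n \<Rightarrow> real) \<Rightarrow> real^'n^'n" where
  "gram_matrix b = (\<chi> i j. b (axis i 1) (axis j 1))"

text \<open>The \<open>g\<close>-trace \<open>g\<^sup>i\<^sup>j Ric\<^sub>j\<^sub>i\<close> of the horizontal Ricci tensor.\<close>

definition h_scalar_curvature :: "('a, real^'n) atlas \<Rightarrow> ('a \<times> (real^'n) \<Rightarrow> real) \<Rightarrow>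
    ('a, real^'n) pi_connection \<Rightarrow> 'a \<times> (real^'n) \<Rightarrow> real" where
  "h_scalar_curvature A L D u =
     trace (matrix_inv (gram_matrix (finsler_metric L u)) ** gram_matrix (h_ricci A D u))"

definition G_tensor :: "('a \<times> (real^'n) \<Rightarrow> real) \<Rightarrow>
    'a \<times> (real^'n) \<Rightarrow> real^'n \<Rightarrow> real^'n \<Rightarrow> real^'n \<Rightarrow> real^'n" where
  "G_tensor L u x y z = finsler_metric L u x z *\<^sub>R y - finsler_metric L u y z *\<^sub>R x"

definition concircular_curvature :: "('a, real^'n) atlas \<Rightarrow> ('a \<times> (real^'n) \<Rightarrow> real) \<Rightarrow>
    ('a, real^'n) pi_connection \<Rightarrow> 'a \<times> (real^'n) \<Rightarrow> real^'n \<Rightarrow> real^'n \<Rightarrow> real^'n \<Rightarrow> real^'n" where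
  "concircular_curvature A L D u x y z =
     h_curvature A D u x y z -
     (h_scalar_curvature A L D u / (real CARD('n) * (real CARD('n) - 1))) *\<^sub>R G_tensor L u x y z"

definition concircularly_flat ::
    "('a, real^'n) atlas \<Rightarrow> ('a \<times> (real^'n) \<Rightarrow> real) \<Rightarrow> ('a, real^'n) pi_connection \<Rightarrow> bool" where
  "concircularly_flat A L D \<longleftrightarrow>
     (\<forall>u\<in>points (slit_tangent A). \<forall>x y z. concircular_curvature A L D u x y z = 0)"

text \<open>
  A scalar function \<open>k\<close> on the slit tangent bundle is nonzero if it is not the zero function there.
  Smoothness of \<open>k\<close> is not asked for separately; it is forced by the equation, since the horizontal
  curvature and \<open>G\<close> are smooth and \<open>G\<close> vanishes nowhere in dimension at least two.
\<close>

definition h_isotropic ::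
    "('a, real^'n) atlas \<Rightarrow> ('a \<times> (real^'n) \<Rightarrow> real) \<Rightarrow> ('a, real^'n) pi_connection \<Rightarrow> bool" where
  "h_isotropic A L D \<longleftrightarrow>
     (\<exists>k. (\<exists>u\<in>points (slit_tangent A). k u \<noteq> 0) \<and>
        (\<forall>u\<in>points (slit_tangent A). \<forall>x y z.
           h_curvature A D u x y z = k u *\<^sub>R G_tensor L u x y z))"

definition h_curvature_vanishes ::
    "('a, real^'n) atlas \<Rightarrow> ('a, real^'n) pi_connection \<Rightarrow> bool" where
  "h_curvature_vanishes A D \<longleftrightarrow>
     (\<forall>u\<in>points (slit_tangent A). \<forall>x y z. h_curvature A D u x y z = 0)"

text \<open>
  If the horizontal curvature vanishes identically (for instance for flat Euclidean or Minkowski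
  spaces) then the manifold is concircularly flat but not \<open>h\<close>-isotropic, because the latter asks
  for a nonzero \<open>k\<close>.
\<close>

lemma h_curvature_vanishes_flat_not_isotropic:
  fixes A :: "('a, real^'n) atlas" and L :: "'a \<times> (real^'n) \<Rightarrow> real"
  assumes L: "finsler_manifold A L" and n: "CARD('n) \<ge> 3" and R: "h_curvature_vanishes A D"
  shows "concircularly_flat A L D" and "\<not> h_isotropic A L D"
proof -
  have "h_scalar_curvature A L D u = 0" if "u \<in> points (slit_tangent A)" for u
  proof -
    have "gram_matrix (h_ricci A D u) = (0 :: real^'n^'n)"
      using R that
      by (simp add: gram_matrix_def h_ricci_def h_curvature_vanishes_def matrix_def trace_def
          vec_eq_iff)
    then show ?thesis
      by (simp add: h_scalar_curvature_def matrix_matrix_mult_def trace_def)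
  qed
  then show "concircularly_flat A L D"
    using R by (simp add: concircularly_flat_def concircular_curvature_def h_curvature_vanishes_def)
  show "\<not> h_isotropic A L D"
  proof
    assume "h_isotropic A L D"
    then obtain k u where u: "u \<in> points (slit_tangent A)" and k: "k u \<noteq> 0"
      and G: "\<And>x y z. h_curvature A D u x y z = k u *\<^sub>R G_tensor L u x y z"
      unfolding h_isotropic_def by blast
    have "card (UNIV :: 'n set) \<noteq> 1" using n by simp
    then obtain i j :: 'n where ij: "i \<noteq> j"
      using is_singletonI' [of "UNIV :: 'n set"] by (auto simp: is_singleton_altdef)
    let ?x = "axis i 1 :: real^'n" and ?y = "axis j 1 :: real^'n"
    have "?x \<noteq> 0" by (simp add: axis_eq_0_iff)
    then have pos: "finsler_metric L u ?x ?x > 0"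
      using L u unfolding finsler_manifold_def by blast
    have "G_tensor L u ?x ?y ?x = 0"
      using G[of ?x ?y ?x] R u k by (simp add: h_curvature_vanishes_def)
    then have "(G_tensor L u ?x ?y ?x) $ j = 0" by simp
    then show False
      using pos ij by (simp add: G_tensor_def axis_def)
  qed
qed

end

(* For R = k G the trace gives Ric = k (n - 1) g, whence r = k n (n - 1) and C = R - k G = 0.
   The traces are taken in the standard basis, so they need that g, defined by iterated
   one-dimensional derivatives of L^2 / 2, is bilinear; this is where the smoothness of L enters.
   Conversely C = 0 says R = (r / (n (n - 1))) G, and this factor is not identically zero because
   R is not. *)

theory Submission
  imports Defs
begin

section \<open>Iterated directional derivatives and bilinearity of the Hessian\<close>

lemma deriv_along_line:
  fixes f :: "'e::real_normed_vector \<Rightarrow> real"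
  assumes "f differentiable (at y)"
  shows "deriv (\<lambda>t. f (y + t *\<^sub>R w)) 0 = frechet_derivative f (at y) w"
proof -
  have f: "(f has_derivative frechet_derivative f (at y)) (at (y + 0 *\<^sub>R w))"
    using assms by (simp add: frechet_derivative_works[symmetric])
  have "((\<lambda>t. y + t *\<^sub>R w) has_derivative (\<lambda>t. t *\<^sub>R w)) (at 0)"
    by (auto intro!: derivative_eq_intros)
  from diff_chain_at[OF this f]
  have "((\<lambda>t. f (y + t *\<^sub>R w)) has_derivative (\<lambda>t. frechet_derivative f (at y) (t *\<^sub>R w))) (at 0)"
    by (simp add: o_def)
  moreover have "(\<lambda>t. frechet_derivative f (at y) (t *\<^sub>R w)) = (*) (frechet_derivative f (at y) w)"
    using linear_frechet_derivative[OF assms] by (simp add: linear_scale fun_eq_iff mult.commute)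
  ultimately show ?thesis
    by (simp add: DERIV_imp_deriv has_field_derivative_def)
qed

context
  fixes f :: "'e::real_normed_vector \<Rightarrow> real" and S :: "'e set" and y :: 'e
  assumes S: "open S" "y \<in> S"
    and f: "\<And>z. z \<in> S \<Longrightarrow> f differentiable (at z)"
    and f': "\<And>w. (\<lambda>z. frechet_derivative f (at z) w) differentiable (at y)"
begin

text \<open>The inner derivative is a Frechet derivative only while \<open>y + s *\<^sub>R v\<close>
  stays in \<open>S\<close>. By openness this holds for \<open>s\<close> near 0, and the outer
  derivative at 0 sees no more than that.\<close>

lemma iterated_deriv_eq_frechet_derivative:
  "deriv (\<lambda>s. deriv (\<lambda>t. f (y + s *\<^sub>R v + t *\<^sub>R w)) 0) 0 =
     frechet_derivative (\<lambda>z. frechet_derivative f (at z) w) (at y) v"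
proof -
  have "((\<lambda>s. y + s *\<^sub>R v) \<longlongrightarrow> y) (nhds (0::real))"
    by (rule tendsto_eq_intros refl filterlim_ident | simp)+
  then have "eventually (\<lambda>s. y + s *\<^sub>R v \<in> S) (nhds (0::real))"
    using S by (rule topological_tendstoD)
  then have "eventually (\<lambda>s. deriv (\<lambda>t. f (y + s *\<^sub>R v + t *\<^sub>R w)) 0 =
      frechet_derivative f (at (y + s *\<^sub>R v)) w) (nhds (0::real))"
    by eventually_elim (simp add: deriv_along_line f)
  then have "deriv (\<lambda>s. deriv (\<lambda>t. f (y + s *\<^sub>R v + t *\<^sub>R w)) 0) 0 =
      deriv (\<lambda>s. frechet_derivative f (at (y + s *\<^sub>R v)) w) 0"
    by (rule deriv_cong_ev) simp
  also have "\<dots> = frechet_derivative (\<lambda>z. frechet_derivative f (at z) w) (at y) v"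
    by (rule deriv_along_line[OF f'])
  finally show ?thesis .
qed

text \<open>Linearity in \<open>v\<close> is that of a Frechet derivative at \<open>y\<close>. For
  linearity in \<open>w\<close>, the first derivative at every \<open>z\<close> of \<open>S\<close>
  is linear in its direction, and differentiating these identities in \<open>z\<close> at
  \<open>y\<close> preserves them.\<close>

lemma bilinear_iterated_deriv:
  "bilinear (\<lambda>v w. deriv (\<lambda>s. deriv (\<lambda>t. f (y + s *\<^sub>R v + t *\<^sub>R w)) 0) 0)"
proof -
  let ?D = "\<lambda>w z. frechet_derivative f (at z) w"
  have lin: "linear (frechet_derivative f (at z))" if "z \<in> S" for z
    using f[OF that] by (rule linear_frechet_derivative)
  have D: "(?D w has_derivative frechet_derivative (?D w) (at y)) (at y)" for w
    using f' by (simp add: frechet_derivative_works[symmetric])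
  have add: "frechet_derivative (?D (v + w)) (at y) =
      (\<lambda>x. frechet_derivative (?D v) (at y) x + frechet_derivative (?D w) (at y) x)" for v w
  proof -
    have "(?D (v + w) has_derivative
        (\<lambda>x. frechet_derivative (?D v) (at y) x + frechet_derivative (?D w) (at y) x)) (at y)"
      using S
      by (rule has_derivative_transform_within_open[OF has_derivative_add[OF D D]])
        (simp add: lin linear_add)
    then show ?thesis by (rule frechet_derivative_at[symmetric])
  qed
  have scale: "frechet_derivative (?D (c *\<^sub>R w)) (at y) =
      (\<lambda>x. c *\<^sub>R frechet_derivative (?D w) (at y) x)" for c w
  proof -
    have "(?D (c *\<^sub>R w) has_derivative (\<lambda>x. c *\<^sub>R frechet_derivative (?D w) (at y) x)) (at y)"
      using S
      by (rule has_derivative_transform_within_open[OF has_derivative_scaleR_right[OF D]])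
        (simp add: lin linear_scale)
    then show ?thesis by (rule frechet_derivative_at[symmetric])
  qed
  show ?thesis
    unfolding iterated_deriv_eq_frechet_derivative bilinear_def
    using linear_frechet_derivative[OF f'] by (auto intro!: linearI simp: add scale)
qed

end

lemma has_derivative_half_square:
  fixes h :: "'e::real_normed_vector \<Rightarrow> real"
  assumes "h differentiable (at z)"
  shows "((\<lambda>z. (h z)\<^sup>2 / 2) has_derivative (\<lambda>w. h z * frechet_derivative h (at z) w)) (at z)"
proof -
  have "(h has_derivative frechet_derivative h (at z)) (at z)"
    using assms by (simp add: frechet_derivative_works[symmetric])
  then show ?thesis
    by (auto intro!: derivative_eq_intros simp: fun_eq_iff)
qed

section \<open>Smoothness of \<open>L\<close> along the fibres and bilinearity of
  \<open>g\<close>\<close>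

lemma chart_at_around:
  assumes "p \<in> points A"
  shows "chart_at A p \<in> A" and "p \<in> cdom (chart_at A p)"
proof -
  have "\<exists>c. c \<in> A \<and> p \<in> cdom c"
    using assms by (auto simp: points_def)
  then have "chart_at A p \<in> A \<and> p \<in> cdom (chart_at A p)"
    unfolding chart_at_def by (rule someI_ex)
  then show "chart_at A p \<in> A" and "p \<in> cdom (chart_at A p)"
    by auto
qed

text \<open>The transition map from a chart to itself is the identity on an open set, hence so is
  its derivative.\<close>

lemma components_chart_at:
  assumes A: "smooth_manifold A" and p: "p \<in> points A"
  shows "components A (chart_at A p) p y = y"
proof -
  let ?c = "chart_at A p"
  have c: "open (cimg ?c)" "cmap ?c p \<in> cimg ?c"
    using A chart_at_around[OF p] by (auto simp: smooth_manifold_def cimg_def)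
  have "(cmap ?c \<circ> cinv ?c has_derivative (\<lambda>x. x)) (at (cmap ?c p))"
    using has_derivative_ident c
    by (rule has_derivative_transform_within_open) (simp add: cinv_def cimg_def f_inv_into_f)
  then show ?thesis
    by (simp add: components_def frechet_derivative_at[symmetric])
qed

text \<open>
  In the chart induced by \<open>chart_at A p\<close> the fibre over \<open>p\<close> has its own vectors as coordinates.
\<close>

lemma cinv_tangent_chart_at:
  assumes A: "smooth_manifold A" and p: "p \<in> points A" and y: "y \<noteq> 0"
  defines "c \<equiv> chart_at A p"
  shows "(cmap c p, y) \<in> cimg (tangent_chart A c)"
    and "cinv (tangent_chart A c) (cmap c p, y) = (p, y)"
proof -
  have c: "c \<in> A" "p \<in> cdom c"
    unfolding c_def using p by (rule chart_at_around)+
  have comp: "components A c p z = z" for z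
    unfolding c_def using A p by (rule components_chart_at)
  have inj: "inj_on (cmap c) (cdom c)"
    using A c by (simp add: smooth_manifold_def)
  show mem: "(cmap c p, y) \<in> cimg (tangent_chart A c)"
    using c y by (auto simp: cimg_def tangent_chart_def comp intro!: image_eqI[of _ _ "(p, y)"])
  \<comment> \<open>\<open>cinv\<close> yields some preimage \<open>(q, z)\<close>. The base
    coordinate forces \<open>q = p\<close> by injectivity of \<open>cmap c\<close>; only then does
    the fibre coordinate, read at \<open>p\<close>, give \<open>z = y\<close>.\<close>
  obtain q z where q: "cinv (tangent_chart A c) (cmap c p, y) = (q, z)"
    by fastforce
  have "(q, z) \<in> cdom (tangent_chart A c)"
    using inv_into_into[OF mem[unfolded cimg_def]] q by (simp add: cinv_def)
  then have "q \<in> cdom c"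
    by (simp add: tangent_chart_def)
  moreover have "cmap (tangent_chart A c) (q, z) = (cmap c p, y)"
    using f_inv_into_f[OF mem[unfolded cimg_def]] q by (simp add: cinv_def)
  then have qz: "cmap c q = cmap c p" "components A c q z = y"
    by (auto simp: tangent_chart_def)
  ultimately have "q = p"
    using inj c by (auto dest: inj_onD)
  with qz q show "cinv (tangent_chart A c) (cmap c p, y) = (p, y)"
    by (simp add: comp)
qed

text \<open>Smoothness of \<open>L\<close> is given in charts of the slit tangent bundle. With the
  base coordinate frozen at \<open>x\<close>, the chart expression \<open>H\<close> restricts to
  \<open>L (p, _)\<close> on nonzero vectors, so both claims follow by the chain rule for
  \<open>z \<mapsto> (x, z)\<close>.\<close>

lemma smooth_fun_slit_tangent_fibre:
  fixes L :: "'a \<times> 'e::euclidean_space \<Rightarrow> real"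
  assumes A: "smooth_manifold A" and L: "smooth_fun (slit_tangent A) L"
    and p: "p \<in> points A" and y: "y \<noteq> 0"
  shows "(\<lambda>z. L (p, z)) differentiable (at y)"
    and "(\<lambda>z. frechet_derivative (\<lambda>z. L (p, z)) (at z) w) differentiable (at y)"
proof -
  define c where "c = chart_at A p"
  define x where "x = cmap c p"
  define H where "H = L \<circ> cinv (tangent_chart A c)"
  have "c \<in> A"
    unfolding c_def using p by (rule chart_at_around)
  then have "smooth_on (cimg (tangent_chart A c)) H"
    using L by (auto simp: smooth_fun_def slit_tangent_def H_def)
  then have "Ck_on (Suc (Suc 0)) (cimg (tangent_chart A c)) H"
    unfolding smooth_on_def by blast
  moreover have xz: "(x, z) \<in> cimg (tangent_chart A c)" if "z \<noteq> 0" for z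
    using cinv_tangent_chart_at(1)[OF A p that] by (simp add: x_def c_def)
  ultimately have H: "H differentiable (at (x, z))"
    "(\<lambda>q. frechet_derivative H (at q) v) differentiable (at (x, z))" if "z \<noteq> 0" for z v
    using that by (cases v, auto)+
  have HL: "H (x, z) = L (p, z)" if "z \<noteq> 0" for z
    using cinv_tangent_chart_at(2)[OF A p that] by (simp add: H_def x_def c_def)
  have op: "open (- {0 :: 'e})" and mem: "z \<in> - {0}" if "z \<noteq> 0" for z :: 'e
    using that by auto
  have pair: "((\<lambda>z. (x, z)) has_derivative (\<lambda>w. (0, w))) (at z)" for z :: 'e
    by (auto intro!: derivative_eq_intros)
  have der: "((\<lambda>z. L (p, z)) has_derivative (\<lambda>w. frechet_derivative H (at (x, z)) (0, w))) (at z)"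
    if "z \<noteq> 0" for z
  proof -
    have "(H has_derivative frechet_derivative H (at (x, z))) (at (x, z))"
      using H(1)[OF that] by (simp add: frechet_derivative_works[symmetric])
    from diff_chain_at[OF pair this, unfolded o_def] show ?thesis
      by (rule has_derivative_transform_within_open[OF _ op mem[OF that]])
        (use that in \<open>auto simp: HL o_def\<close>)
  qed
  show "(\<lambda>z. L (p, z)) differentiable (at y)"
    using der[OF y] by (auto simp: differentiable_def)
  \<comment> \<open>A fibre direction \<open>w\<close> is the direction \<open>(0, w)\<close> in the
    chart. By \<open>der\<close>, the derivative of \<open>H\<close> in that direction is the
    derivative of \<open>L (p, _)\<close> at all nonzero \<open>z\<close>, a neighbourhood of
    \<open>y\<close>.\<close>
  obtain B where "((\<lambda>q. frechet_derivative H (at q) (0, w)) has_derivative B) (at (x, y))"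
    using H(2)[OF y] by (auto simp: differentiable_def)
  from diff_chain_at[OF pair this]
  have "((\<lambda>z. frechet_derivative (\<lambda>z. L (p, z)) (at z) w) has_derivative B \<circ> (\<lambda>w. (0, w))) (at y)"
    by (rule has_derivative_transform_within_open[OF _ op mem[OF y]])
      (use y in \<open>auto simp: frechet_derivative_at[OF der, symmetric] o_def\<close>)
  then show "(\<lambda>z. frechet_derivative (\<lambda>z. L (p, z)) (at z) w) differentiable (at y)"
    by (auto simp: differentiable_def)
qed

text \<open>This is \<open>bilinear_iterated_deriv\<close> for \<open>f = L\<^sup>2 / 2\<close> on
  one fibre. The open set is the complement of 0, where \<open>L\<close> is smooth; it contains
  \<open>y\<close> because \<open>u\<close> lies in the slit bundle.\<close>

lemma bilinear_finsler_metric: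
  fixes A :: "('a, real^'n) atlas"
  assumes FM: "finsler_manifold A L" and u: "u \<in> points (slit_tangent A)"
  shows "bilinear (finsler_metric L u)"
proof -
  obtain p y where py: "u = (p, y)" "p \<in> points A" "y \<noteq> 0"
    using u by (auto simp: points_def slit_tangent_def tangent_chart_def)
  let ?h = "\<lambda>z. L (p, z)"
  have A: "smooth_manifold A" and L: "smooth_fun (slit_tangent A) L"
    using FM by (auto simp: finsler_manifold_def)
  note h = smooth_fun_slit_tangent_fibre[OF A L py(2)]
  have der: "((\<lambda>z. (?h z)\<^sup>2 / 2) has_derivative (\<lambda>w. ?h z * frechet_derivative ?h (at z) w)) (at z)"
    if "z \<noteq> 0" for z
    using h(1)[OF that] by (rule has_derivative_half_square)
  have mem: "open (- {0 :: real^'n})" "y \<in> - {0}"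
    using py by auto
  \<comment> \<open>By \<open>der\<close> this product is the first derivative of
    \<open>L\<^sup>2 / 2\<close> in direction \<open>w\<close> away from 0, so its differentiability
    supplies the second derivative.\<close>
  have "(\<lambda>z. ?h z * frechet_derivative ?h (at z) w) differentiable (at y)" for w
    using h py(3) by (intro differentiable_mult) auto
  then have "((\<lambda>z. ?h z * frechet_derivative ?h (at z) w) has_derivative
      frechet_derivative (\<lambda>z. ?h z * frechet_derivative ?h (at z) w) (at y)) (at y)" for w
    by (rule frechet_derivative_works[THEN iffD1])
  then have "((\<lambda>z. frechet_derivative (\<lambda>z. (?h z)\<^sup>2 / 2) (at z) w) has_derivative
      frechet_derivative (\<lambda>z. ?h z * frechet_derivative ?h (at z) w) (at y)) (at y)" for w
    by (rule has_derivative_transform_within_open[OF _ mem])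
      (auto simp: frechet_derivative_at[OF der, symmetric])
  then have diff2: "(\<lambda>z. frechet_derivative (\<lambda>z. (?h z)\<^sup>2 / 2) (at z) w) differentiable (at y)" for w
    by (rule differentiableI)
  have diff1: "(\<lambda>z. (?h z)\<^sup>2 / 2) differentiable (at z)" if "z \<in> - {0}" for z
    using that by (intro differentiableI[OF der]) simp
  from bilinear_iterated_deriv[OF mem diff1 diff2] show ?thesis
    by (simp add: finsler_metric_def[abs_def] py(1))
qed

section \<open>Gram matrices and traces\<close>

lemma bilinear_eq_gram_matrix:
  assumes "bilinear b"
  shows "b v w = v \<bullet> (gram_matrix b *v w)"
proof -
  have "b v w = b (\<Sum>i\<in>UNIV. v $ i *\<^sub>R axis i 1) (\<Sum>j\<in>UNIV. w $ j *\<^sub>R axis j 1)"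
    using basis_expansion[of v] basis_expansion[of w] by (simp add: scalar_mult_eq_scaleR)
  also have "\<dots> = (\<Sum>i\<in>UNIV. \<Sum>j\<in>UNIV. v $ i * (w $ j * b (axis i 1) (axis j 1)))"
    unfolding bilinear_sum[OF assms] sum.cartesian_product[symmetric]
    by (simp add: bilinear_lmul[OF assms] bilinear_rmul[OF assms] mult.left_commute)
  also have "\<dots> = v \<bullet> (gram_matrix b *v w)"
    by (simp add: inner_vec_def gram_matrix_def matrix_vector_mult_def sum_distrib_left ac_simps)
  finally show ?thesis .
qed

text \<open>A kernel vector \<open>v\<close> satisfies \<open>b v v = v \<bullet> 0 = 0\<close>, so
  definiteness makes it zero; a square matrix with trivial kernel is invertible.\<close>

lemma invertible_gram_matrix:
  assumes "bilinear b" and "\<And>v. v \<noteq> 0 \<Longrightarrow> b v v > 0"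
  shows "invertible (gram_matrix b)"
proof -
  have "v = 0" if "gram_matrix b *v v = 0" for v
    using assms(2)[of v] bilinear_eq_gram_matrix[OF assms(1), of v v] that by fastforce
  then show ?thesis
    by (simp add: invertible_left_inverse matrix_left_invertible_ker)
qed

text \<open>As a map of \<open>y\<close>, \<open>G\<close> is \<open>g(x,z)\<close> times the
  identity minus the rank-one map \<open>y \<mapsto> g(y,z) x\<close>. Their traces are
  \<open>n g(x,z)\<close> and \<open>g(x,z)\<close>, the latter by expanding \<open>x\<close> in the
  standard basis.\<close>

lemma trace_G_tensor:
  fixes L :: "'a \<times> (real^'n) \<Rightarrow> real"
  assumes "bilinear (finsler_metric L u)"
  shows "trace (matrix (\<lambda>y. k *\<^sub>R G_tensor L u x y z)) =
           k * (real CARD('n) - 1) * finsler_metric L u x z"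
proof -
  let ?g = "finsler_metric L u"
  have lin: "linear (\<lambda>x. ?g x z)"
    using assms by (simp add: bilinear_def)
  have "?g x z = ?g (\<Sum>i\<in>UNIV. x $ i *\<^sub>R axis i 1) z"
    using basis_expansion[of x] by (simp add: scalar_mult_eq_scaleR)
  also have "\<dots> = (\<Sum>i\<in>UNIV. x $ i * ?g (axis i 1) z)"
    by (simp add: linear_sum[OF lin] linear_scale[OF lin])
  finally have x: "(\<Sum>i\<in>UNIV. x $ i * ?g (axis i 1) z) = ?g x z" by simp
  show ?thesis
    by (simp add: trace_def matrix_def G_tensor_def sum_distrib_left[symmetric] sum_subtractf x
        algebra_simps)
qed

text \<open>The computation is pointwise: \<open>k\<close> is a number attached to the single point
  \<open>u\<close>, so a factor varying over the slit bundle enters with no derivatives.\<close>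

lemma h_scalar_curvature_isotropic:
  fixes A :: "('a, real^'n) atlas"
  assumes FM: "finsler_manifold A L" and u: "u \<in> points (slit_tangent A)"
    and R: "\<And>x y z. h_curvature A D u x y z = k *\<^sub>R G_tensor L u x y z"
  shows "h_scalar_curvature A L D u = k * (real CARD('n) * (real CARD('n) - 1))"
proof -
  let ?g = "finsler_metric L u" and ?c = "k * (real CARD('n) - 1)"
  have bil: "bilinear ?g"
    using FM u by (rule bilinear_finsler_metric)
  then have "invertible (gram_matrix ?g)"
    using FM u by (intro invertible_gram_matrix) (auto simp: finsler_manifold_def)
  \<comment> \<open>\<open>matrix_inv\<close> is a choice of two-sided inverse, so existence of one
    makes it a left inverse.\<close>
  then have "\<exists>B. gram_matrix ?g ** B = mat 1 \<and> B ** gram_matrix ?g = mat 1"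
    by (simp add: invertible_def)
  then have inv: "matrix_inv (gram_matrix ?g) ** gram_matrix ?g = mat 1"
    unfolding matrix_inv_def by (rule someI2_ex) blast
  have "gram_matrix (h_ricci A D u) = ?c *\<^sub>R gram_matrix ?g"
    by (simp add: gram_matrix_def h_ricci_def R trace_G_tensor[OF bil] vec_eq_iff)
  then have "matrix_inv (gram_matrix ?g) ** gram_matrix (h_ricci A D u) =
      ?c *\<^sub>R (mat 1 :: real^'n^'n)"
    by (simp only: matrix_scalar_ac scalar_matrix_assoc[symmetric] inv)
  then show ?thesis
    by (simp add: h_scalar_curvature_def trace_def mat_def)
qed

theorem proposition2p4:
  fixes A :: "('a, real^'n) atlas"
    and L :: "'a \<times> (real^'n) \<Rightarrow> real"
    and D :: "('a, real^'n) pi_connection"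
  assumes "finsler_manifold A L"
    and "cartan_connection A L D"
    and "CARD('n) \<ge> 3"
    and "\<not> h_curvature_vanishes A D"
  shows "concircularly_flat A L D \<longleftrightarrow> h_isotropic A L D"
proof
  assume flat: "concircularly_flat A L D"
  let ?k = "\<lambda>u. h_scalar_curvature A L D u / (real CARD('n) * (real CARD('n) - 1))"
  have R: "\<forall>u\<in>points (slit_tangent A). \<forall>x y z.
      h_curvature A D u x y z = ?k u *\<^sub>R G_tensor L u x y z"
    using flat by (simp add: concircularly_flat_def concircular_curvature_def)
  \<comment> \<open>One such point is enough, since \<open>h_isotropic\<close> reads "nonzero" as
    not identically zero.\<close>
  moreover have "\<exists>u\<in>points (slit_tangent A). ?k u \<noteq> 0"
    using R assms(4) unfolding h_curvature_vanishes_def by force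
  ultimately show "h_isotropic A L D"
    unfolding h_isotropic_def by (intro exI[of _ ?k]) blast
next
  assume "h_isotropic A L D"
  then obtain k where R: "\<And>u x y z. u \<in> points (slit_tangent A) \<Longrightarrow>
      h_curvature A D u x y z = k u *\<^sub>R G_tensor L u x y z"
    unfolding h_isotropic_def by blast
  \<comment> \<open>Needed to cancel the normalising factor in \<open>C\<close>: division by zero
    would give coefficient 0 instead of \<open>k u\<close>.\<close>
  have "real CARD('n) * (real CARD('n) - 1) \<noteq> 0"
    using assms(3) by simp
  then show "concircularly_flat A L D"
    using h_scalar_curvature_isotropic[OF assms(1) _ R]
    by (simp add: concircularly_flat_def concircular_curvature_def R)
qed

end
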